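(* Let $a$ be a non-negative integer. Then for any integer $m$ satisfying $0\leq m\leq a$, we have \begin{align*} &\binom{a+1}{m+1}\sum_{j=0}^{a+1}t_{\mathcal{A}}(\{1\}^{j},2,\{1\}^{a-j+1})+(-1)^m\sum_{j=0}^{a-m}t_{\mathcal{A}}(\{1\}^{j},2,\{1\}^{a-j+1})\\ &=-\sum_{i=0}^a\sum_{j=0}^i\binom{i}{a-m}M_{\mathcal{A}}(\{1\}^{a-j+1},2,\{1\}^{j};\{1\}^{a-i+1},\{-1\}^{i+1}). \end{align*}
   Context: Let $\mathcal{P}$ be the set of primes and $\mathcal{A}:=\prod_{p\in\mathcal{P}}(\mathbb{Z}/p\mathbb{Z})\big/\bigoplus_{p\in\mathcal{P}}(\mathbb{Z}/p\mathbb{Z})$, in which an element is determined by its components at all but finitely many primes. For positive integers $k_1,\ldots,k_r$, signs $\varepsilon_1,\ldots,\varepsilon_r\in\{\pm1\}$ and a positive integer $N$, put $$M_N(k_1,\ldots,k_r;\varepsilon_1,\ldots,\varepsilon_r):=\sum_{0<m_1<\cdots<m_r<N}\frac{(1+\varepsilon_1(-1)^{m_1})\cdots(1+\varepsilon_r(-1)^{m_r})}{m_1^{k_1}\cdots m_r^{k_r}},$$ and define the finite multiple mixed value $M_{\mathcal{A}}(k_1,\ldots,k_r;\varepsilon_1,\ldots,\varepsilon_r):=\bigl(M_p(k_1,\ldots,k_r;\varepsilon_1,\ldots,\varepsilon_r)\bmod p\bigr)_{p\in\mathcal{P}}\in\mathcal{A}$. The symbol $\{c\}^n$ denotes the string $c,\ldots,c$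 with $n$ repetitions (empty if $n=0$). The finite multiple $t$-value is $t_{\mathcal{A}}(k_1,\ldots,k_r):=M_{\mathcal{A}}(k_1,\ldots,k_r;\{-1\}^r)$. Binomial coefficients $\binom{i}{m}$ are $0$ if $m>i$. *)

theory Defs
  imports Complex_Main "HOL-Number_Theory.Number_Theory"
begin

section \<open>The product of the prime fields\<close>

text \<open>
  The elements of \<open>\<Prod>\<^sub>p \<int>/p\<int>\<close>, where \<open>p\<close> ranges over the primes. A residue class
  modulo \<open>p\<close> is represented by its representative in \<open>{0..<p}\<close>; the components at indices
  that are not prime carry no information and are fixed to be \<open>0\<close>.
\<close>

typedef prime_prod =
  "{f :: nat \<Rightarrow> int. \<forall>p. if prime p then f p \<in> {0..<int p} else f p = 0}"
  morphisms component Abs_prime_prod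
  by (intro exI[of _ "\<lambda>_. 0"]) (auto simp: prime_gt_0_nat)

setup_lifting type_definition_prime_prod

lift_definition prime_prod_of :: "(nat \<Rightarrow> int) \<Rightarrow> prime_prod"
  is "\<lambda>f p. if prime p then f p mod int p else 0"
  by (auto simp: prime_gt_0_nat)

lemma component_prime_prod_of:
  "prime p \<Longrightarrow> component (prime_prod_of f) p = f p mod int p"
  by transfer simp

lemma component_mod: "prime p \<Longrightarrow> component x p mod int p = component x p"
  using component[of x] by (auto dest!: spec[of _ p])

lemma prime_prod_eqI:
  assumes "\<And>p. prime p \<Longrightarrow> component x p = component y p"
  shows   "x = y"
proof -
  have "component x p = component y p" for p
    using assms[of p] component[of x] component[of y] by (cases "prime p") auto
  hence "component x = component y"
    by (rule ext)
  thus ?thesis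
    by (simp only: component_inject)
qed

instantiation prime_prod :: comm_ring_1
begin

lift_definition zero_prime_prod :: prime_prod is "\<lambda>_. 0"
  by (auto simp: prime_gt_0_nat)

lift_definition one_prime_prod :: prime_prod is "\<lambda>p. if prime p then 1 mod int p else 0"
  by (auto simp: prime_gt_0_nat)

lift_definition plus_prime_prod :: "prime_prod \<Rightarrow> prime_prod \<Rightarrow> prime_prod"
  is "\<lambda>f g p. if prime p then (f p + g p) mod int p else 0"
  by (auto simp: prime_gt_0_nat)

lift_definition minus_prime_prod :: "prime_prod \<Rightarrow> prime_prod \<Rightarrow> prime_prod"
  is "\<lambda>f g p. if prime p then (f p - g p) mod int p else 0"
  by (auto simp: prime_gt_0_nat)

lift_definition uminus_prime_prod :: "prime_prod \<Rightarrow> prime_prod"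
  is "\<lambda>f p. if prime p then (- f p) mod int p else 0"
  by (auto simp: prime_gt_0_nat)

lift_definition times_prime_prod :: "prime_prod \<Rightarrow> prime_prod \<Rightarrow> prime_prod"
  is "\<lambda>f g p. if prime p then (f p * g p) mod int p else 0"
  by (auto simp: prime_gt_0_nat)

instance
proof
  fix a b c :: prime_prod
  note eqI = prime_prod_eqI
    and reps = zero_prime_prod.rep_eq one_prime_prod.rep_eq plus_prime_prod.rep_eq
      minus_prime_prod.rep_eq uminus_prime_prod.rep_eq times_prime_prod.rep_eq
  show "a + b + c = a + (b + c)"
    by (rule eqI) (simp add: reps mod_add_left_eq mod_add_right_eq add.assoc)
  show "a + b = b + a"
    by (rule eqI) (simp add: reps add.commute)
  show "0 + a = a"
    by (rule eqI) (simp add: reps component_mod)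
  show "- a + a = 0"
    by (rule eqI) (simp add: reps mod_add_left_eq)
  show "a - b = a + - b"
    by (rule eqI) (simp add: reps mod_add_right_eq)
  show "a * b * c = a * (b * c)"
    by (rule eqI) (simp add: reps mod_mult_left_eq mod_mult_right_eq mult.assoc)
  show "a * b = b * a"
    by (rule eqI) (simp only: reps mult.commute)
  show "1 * a = a"
    by (rule eqI) (simp add: reps mod_mult_left_eq component_mod)
  show "(a + b) * c = a * c + b * c"
    by (rule eqI) (simp add: reps mod_mult_left_eq mod_add_eq distrib_right)
  have "component 0 2 \<noteq> component 1 2"
    by (simp add: reps)
  thus "(0 :: prime_prod) \<noteq> 1"
    by auto
qed

end

section \<open>The ring \<open>\<A>\<close>\<close>

definition prime_direct_sum :: "prime_prod set" where
  "prime_direct_sum = {x. finite {p. component x p \<noteq> 0}}"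

lemma prime_direct_sum_zero: "0 \<in> prime_direct_sum"
  by (simp add: prime_direct_sum_def zero_prime_prod.rep_eq)

lemma prime_direct_sum_add:
  assumes "x \<in> prime_direct_sum" "y \<in> prime_direct_sum"
  shows   "x + y \<in> prime_direct_sum"
proof -
  have "{p. component (x + y) p \<noteq> 0} \<subseteq> {p. component x p \<noteq> 0} \<union> {p. component y p \<noteq> 0}"
    by (auto simp: plus_prime_prod.rep_eq split: if_splits)
  thus ?thesis
    using assms by (auto simp: prime_direct_sum_def intro: finite_subset)
qed

lemma prime_direct_sum_mult:
  assumes "x \<in> prime_direct_sum"
  shows   "c * x \<in> prime_direct_sum"
proof -
  have "{p. component (c * x) p \<noteq> 0} \<subseteq> {p. component x p \<noteq> 0}"
    by (auto simp: times_prime_prod.rep_eq split: if_splits)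
  thus ?thesis
    using assms by (auto simp: prime_direct_sum_def intro: finite_subset)
qed

lemma prime_direct_sum_uminus: "x \<in> prime_direct_sum \<Longrightarrow> - x \<in> prime_direct_sum"
  using prime_direct_sum_mult[of x "-1"] by simp

lemma one_notin_prime_direct_sum: "1 \<notin> prime_direct_sum"
proof
  have "{p. component 1 p \<noteq> 0} = {p :: nat. prime p}"
    by (auto simp: one_prime_prod.rep_eq dest: prime_gt_1_nat)
  moreover assume "1 \<in> prime_direct_sum"
  ultimately show False
    using primes_infinite by (simp add: prime_direct_sum_def)
qed

definition cong_direct_sum :: "prime_prod \<Rightarrow> prime_prod \<Rightarrow> bool" where
  "cong_direct_sum x y \<longleftrightarrow> x - y \<in> prime_direct_sum"

quotient_type fin_adele = prime_prod / cong_direct_sum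
proof (intro equivpI reflpI sympI transpI)
  fix x y z :: prime_prod
  show "cong_direct_sum x x"
    by (simp add: cong_direct_sum_def prime_direct_sum_zero)
  show "cong_direct_sum y x" if "cong_direct_sum x y"
    using prime_direct_sum_uminus[of "x - y"] that by (simp add: cong_direct_sum_def)
  show "cong_direct_sum x z" if "cong_direct_sum x y" "cong_direct_sum y z"
    using prime_direct_sum_add[of "x - y" "y - z"] that by (simp add: cong_direct_sum_def)
qed

instantiation fin_adele :: comm_ring_1
begin

lift_definition zero_fin_adele :: fin_adele is 0 .

lift_definition one_fin_adele :: fin_adele is 1 .

lift_definition plus_fin_adele :: "fin_adele \<Rightarrow> fin_adele \<Rightarrow> fin_adele" is "(+)"
  unfolding cong_direct_sum_def add_diff_add by (rule prime_direct_sum_add)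

lift_definition uminus_fin_adele :: "fin_adele \<Rightarrow> fin_adele" is uminus
  unfolding cong_direct_sum_def minus_diff_minus by (rule prime_direct_sum_uminus)

lift_definition minus_fin_adele :: "fin_adele \<Rightarrow> fin_adele \<Rightarrow> fin_adele" is "(-)"
proof -
  fix x x' y y' assume "cong_direct_sum x x'" "cong_direct_sum y y'"
  hence "(x - x') + - (y - y') \<in> prime_direct_sum"
    unfolding cong_direct_sum_def by (intro prime_direct_sum_add prime_direct_sum_uminus)
  also have "(x - x') + - (y - y') = (x - y) - (x' - y')"
    by simp
  finally show "cong_direct_sum (x - y) (x' - y')"
    unfolding cong_direct_sum_def .
qed

lift_definition times_fin_adele :: "fin_adele \<Rightarrow> fin_adele \<Rightarrow> fin_adele" is "(*)"
proof -
  fix x x' y y' assume "cong_direct_sum x x'" "cong_direct_sum y y'"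
  hence "y * (x - x') + x' * (y - y') \<in> prime_direct_sum"
    unfolding cong_direct_sum_def by (intro prime_direct_sum_add prime_direct_sum_mult)
  also have "y * (x - x') + x' * (y - y') = x * y - x' * y'"
    by (simp add: algebra_simps)
  finally show "cong_direct_sum (x * y) (x' * y')"
    unfolding cong_direct_sum_def .
qed

instance
proof
  have refl: "cong_direct_sum x y" if "x = y" for x y
    using that by (simp add: cong_direct_sum_def prime_direct_sum_zero)
  fix a b c :: fin_adele
  show "a + b + c = a + (b + c)"
    by transfer (rule refl, simp add: algebra_simps)
  show "a + b = b + a"
    by transfer (rule refl, simp add: algebra_simps)
  show "0 + a = a"
    by transfer (rule refl, simp)
  show "- a + a = 0"
    by transfer (rule refl, simp)
  show "a - b = a + - b"
    by transfer (rule refl, simp)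
  show "a * b * c = a * (b * c)"
    by transfer (rule refl, simp add: algebra_simps)
  show "a * b = b * a"
    by transfer (rule refl, simp add: algebra_simps)
  show "1 * a = a"
    by transfer (rule refl, simp)
  show "(a + b) * c = a * c + b * c"
    by transfer (rule refl, simp add: algebra_simps)
  show "(0 :: fin_adele) \<noteq> 1"
  proof transfer
    show "\<not> cong_direct_sum 0 1"
      using prime_direct_sum_uminus[of "-1"] one_notin_prime_direct_sum
      by (auto simp: cong_direct_sum_def)
  qed
qed

end

section \<open>Finite multiple mixed values\<close>

text \<open>
  Reduction of a rational number modulo \<open>p\<close>, meaningful if \<open>p\<close> does not divide its denominator.
\<close>

definition rat_mod :: "nat \<Rightarrow> rat \<Rightarrow> int" where
  "rat_mod p q = (case quotient_of q of (a, b) \<Rightarrow> a * modular_inverse (int p) b mod int p)"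

text \<open>
  In what follows the lists \<open>ks\<close> and \<open>es\<close> are meant to have the same length \<open>r\<close>, the entries of
  \<open>es\<close> being \<open>1\<close> or \<open>-1\<close>. A tuple \<open>0 < m\<^sub>1 < \<dots> < m\<^sub>r < N\<close> is a strictly increasing list.
\<close>

definition mixed_sum :: "nat \<Rightarrow> nat list \<Rightarrow> int list \<Rightarrow> rat" where
  "mixed_sum N ks es =
     (\<Sum>ms | length ms = length ks \<and> sorted_wrt (<) ms \<and> (\<forall>m\<in>set ms. 0 < m \<and> m < N).
        (\<Prod>i<length ks. 1 + of_int (es ! i) * (-1) ^ (ms ! i)) /
        (\<Prod>i<length ks. of_nat (ms ! i) ^ (ks ! i)))"

definition fin_mixed_value :: "nat list \<Rightarrow> int list \<Rightarrow> fin_adele" where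
  "fin_mixed_value ks es =
     abs_fin_adele (prime_prod_of (\<lambda>p. rat_mod p (mixed_sum p ks es)))"

definition fin_t_value :: "nat list \<Rightarrow> fin_adele" where
  "fin_t_value ks = fin_mixed_value ks (replicate (length ks) (-1))"

end

theory Submission
  imports Defs "HOL-Computational_Algebra.Polynomial"
begin

text \<open>
  Let \<open>p = 2q + 1\<close>. Modulo \<open>p\<close>, replace every odd \<open>m\<close> in the denominators by \<open>m - p\<close>. The weights
  \<open>2/m\<close> then become \<open>1/k\<close> for \<open>m = 2k\<close> even and \<open>-1/i\<close> for \<open>m = p - 2i\<close> odd, and the claim holds
  exactly over the rationals. Indeed, attach \<open>u\<close> to each even and \<open>B + u\<close> to each odd entry of a chain.
  Sorting by the last even entry turns the sum of all mixed values with one marked odd entry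
  into a convolution of \<open>(u)\<^sub>k/k!\<close>, where \<open>(u)\<^sub>k\<close> is the rising factorial, with the derivative of
  \<open>\<Prod>i. 1 - (B + u)/(i + \<delta>)\<close> at \<open>\<delta> = 0\<close>. By Vandermonde's identity, this
  convolution satisfies the same first-order recurrence in \<open>q\<close> as the generating function of
  the \<open>t\<close>-values. Put \<open>B = x * u\<close>, compare coefficients of \<open>u ^ (a + 2)\<close>, divide by \<open>1 + x\<close>, and compare
  coefficients of \<open>x ^ (a - m)\<close>.
\<close>

section \<open>A convolution identity\<close>

text \<open>The coefficient of \<open>z ^ k\<close> in \<open>(1 - z) ^ (- u)\<close>. As a product,
  \<open>multichoose (1 + c) k\<close> has the factors \<open>1 + c/i\<close> for
  \<open>1 \<le> i \<le> k\<close>; chains produce it in this form.\<close>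

definition multichoose :: "rat \<Rightarrow> nat \<Rightarrow> rat" where
  "multichoose u k = pochhammer u k / fact k"

lemma multichoose_0 [simp]: "multichoose u 0 = 1"
  by (simp add: multichoose_def)

lemma multichoose_Suc: "of_nat (Suc k) * multichoose u (Suc k) = (u + of_nat k) * multichoose u k"
  by (simp add: multichoose_def pochhammer_Suc field_simps del: of_nat_Suc)

lemma multichoose_Suc': "of_nat (Suc k) * multichoose u (Suc k) = u * multichoose (u + 1) k"
  by (simp add: multichoose_def pochhammer_rec field_simps del: of_nat_Suc)

lemma multichoose_zero_Suc: "multichoose 0 (Suc k) = 0"
  by (simp add: multichoose_def pochhammer_rec)

lemma multichoose_add:
  "(\<Sum>k\<le>n. multichoose u k * multichoose v (n - k)) = multichoose (u + v) n"
proof -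
  have "multichoose (u + v) n =
      (\<Sum>k\<le>n. of_nat (n choose k) * pochhammer u k * pochhammer v (n - k)) / fact n"
    by (simp add: multichoose_def pochhammer_binomial_sum)
  also have "\<dots> = (\<Sum>k\<le>n. multichoose u k * multichoose v (n - k))"
    unfolding sum_divide_distrib
    by (intro sum.cong refl) (simp add: multichoose_def binomial_fact)
  finally show ?thesis ..
qed

text \<open>
  \<open>marked_prod A r\<close> is \<open>\<Sum>i\<le>r. A/i\<^sup>2 * (\<Prod>j\<noteq>i. 1 - A/j)\<close>, the derivative at \<open>\<delta> = 0\<close> of
  \<open>\<Prod>j\<le>r. 1 - A/(j + \<delta>)\<close>, and \<open>split_prod B u r\<close> is
  \<open>\<Sum>i\<le>r. (\<Prod>j<i. 1 + u/j) * u/i\<^sup>2 * (\<Prod>i<j\<le>r. 1 - B/j)\<close>.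
\<close>

primrec marked_prod :: "rat \<Rightarrow> nat \<Rightarrow> rat" where
  "marked_prod A 0 = 0"
| "marked_prod A (Suc r) = (1 - A / of_nat (Suc r)) * marked_prod A r
     + A / of_nat (Suc r) ^ 2 * multichoose (1 - A) r"

primrec split_prod :: "rat \<Rightarrow> rat \<Rightarrow> nat \<Rightarrow> rat" where
  "split_prod B u 0 = 0"
| "split_prod B u (Suc r) = (1 - B / of_nat (Suc r)) * split_prod B u r
     + multichoose u (Suc r) / of_nat (Suc r)"

text \<open>Rewriting the source term as a \<open>multichoose\<close> with parameter
  \<open>- A\<close> lets Vandermonde's identity sum it later.\<close>

lemma marked_prod_rec:
  "of_nat (Suc r) * marked_prod A (Suc r) =
     (of_nat (Suc r) - A) * marked_prod A r - multichoose (- A) (Suc r)"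
proof -
  have "multichoose (- A) (Suc r) = - A * multichoose (1 - A) r / of_nat (Suc r)"
    using multichoose_Suc'[of r "- A"] by (simp add: field_simps del: of_nat_Suc)
  thus ?thesis
    by (simp add: field_simps power2_eq_square del: of_nat_Suc)
qed

lemma split_prod_rec:
  "of_nat (Suc r) * split_prod B u (Suc r) =
     (of_nat (Suc r) - B) * split_prod B u r + multichoose u (Suc r)"
  by (simp add: field_simps del: of_nat_Suc)

text \<open>After multiplication by \<open>Suc q\<close>, both sides obey one recurrence, with
  factor \<open>Suc q - B\<close> and source
  \<open>multichoose u (Suc q) - multichoose (- B) (Suc q)\<close>.\<close>

lemma sum_multichoose_marked_prod:
  "(\<Sum>k\<le>q. multichoose u k * marked_prod (B + u) (q - k)) = marked_prod B q + split_prod B u q"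
proof (induction q)
  case 0
  show ?case by simp
next
  case (Suc q)
  define A where "A = B + u"
  let ?c = multichoose and ?Q = "marked_prod A"
  \<comment> \<open>Split \<open>Suc q\<close> as \<open>k + (Suc q - k)\<close>, so that each
    factor can use its own recurrence.\<close>
  have "of_nat (Suc q) * (\<Sum>k\<le>Suc q. ?c u k * ?Q (Suc q - k)) =
      (\<Sum>k\<le>Suc q. of_nat k * ?c u k * ?Q (Suc q - k))
      + (\<Sum>k\<le>Suc q. ?c u k * (of_nat (Suc q - k) * ?Q (Suc q - k)))"
    unfolding sum_distrib_left sum.distrib[symmetric]
    by (intro sum.cong refl) (simp add: of_nat_diff algebra_simps)
  also have "(\<Sum>k\<le>Suc q. of_nat k * ?c u k * ?Q (Suc q - k)) =
      (\<Sum>k\<le>q. (u + of_nat k) * ?c u k * ?Q (q - k))"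
    by (subst sum.atMost_Suc_shift) (simp only: multichoose_Suc, simp)
  also have "(\<Sum>k\<le>Suc q. ?c u k * (of_nat (Suc q - k) * ?Q (Suc q - k))) =
      (\<Sum>k\<le>q. ?c u k * ((of_nat (Suc (q - k)) - A) * ?Q (q - k) - ?c (- A) (Suc (q - k))))"
    by (simp only: sum.atMost_Suc)
       (simp add: Suc_diff_le marked_prod_rec del: of_nat_Suc marked_prod.simps(2))
  \<comment> \<open>The factors \<open>u + k\<close> and \<open>q - k + 1 - A\<close> add up to
    \<open>q + 1 - B\<close>, which is free of \<open>k\<close>.\<close>
  also have "(\<Sum>k\<le>q. (u + of_nat k) * ?c u k * ?Q (q - k)) + \<dots> =
      (of_nat (Suc q) - B) * (\<Sum>k\<le>q. ?c u k * ?Q (q - k))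
      - (\<Sum>k\<le>q. ?c u k * ?c (- A) (Suc q - k))"
    unfolding sum_distrib_left sum.distrib[symmetric] sum_subtractf[symmetric]
    by (intro sum.cong refl) (simp add: of_nat_diff Suc_diff_le A_def algebra_simps)
  \<comment> \<open>The full Vandermonde sum has parameter \<open>u - A = - B\<close>; its term
    \<open>k = Suc q\<close> is missing here.\<close>
  also have "(\<Sum>k\<le>q. ?c u k * ?c (- A) (Suc q - k)) = ?c (- B) (Suc q) - ?c u (Suc q)"
    using multichoose_add[of u "- A" "Suc q"] by (simp add: A_def)
  also have "(of_nat (Suc q) - B) * (\<Sum>k\<le>q. ?c u k * ?Q (q - k)) -
        (?c (- B) (Suc q) - ?c u (Suc q)) =
      of_nat (Suc q) * (marked_prod B (Suc q) + split_prod B u (Suc q))"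
    using Suc.IH unfolding distrib_left marked_prod_rec split_prod_rec
    by (simp add: A_def algebra_simps)
  finally show ?case
    unfolding A_def by (metis mult_left_cancel of_nat_neq_0)
qed

section \<open>Sums over chains\<close>

text \<open>The head of the list is the weight of the largest entry of the chain.\<close>

primrec chain_sum :: "(nat \<Rightarrow> rat) list \<Rightarrow> nat \<Rightarrow> rat" where
  "chain_sum [] N = 1"
| "chain_sum (g # gs) N = (\<Sum>m\<in>{0<..<N}. g m * chain_sum gs m)"

lemma chain_sum_Suc:
  "N > 0 \<Longrightarrow> chain_sum (g # gs) (Suc N) = chain_sum (g # gs) N + g N * chain_sum gs N"
proof -
  assume "N > 0"
  hence "{0<..<Suc N} = insert N {0<..<N}" by auto
  thus ?thesis by simp
qed

lemma chain_sum_1: "chain_sum gs (Suc 0) = (if gs = [] then 1 else 0)"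
proof -
  have "{0<..<Suc 0} = {}" by auto
  thus ?thesis by (cases gs) simp_all
qed

text \<open>Such a chain needs more integers than lie strictly between 0 and
  \<open>N\<close>.\<close>

lemma chain_sum_eq_0: "gs \<noteq> [] \<Longrightarrow> N \<le> length gs \<Longrightarrow> chain_sum gs N = 0"
proof (induction gs arbitrary: N)
  case (Cons g gs)
  show ?case
  proof (cases "gs = []")
    case True
    hence "{0<..<N} = {}" using Cons.prems by auto
    thus ?thesis by simp
  next
    case False
    thus ?thesis using Cons by (auto intro!: sum.neutral)
  qed
qed simp

text \<open>The new bound allows \<open>N\<close> as largest entry. For \<open>s > 0\<close> this
  uses up one copy of \<open>g\<close>; for \<open>s = 0\<close> only the chains of
  \<open>gs\<close> change.\<close>

lemma chain_sum_replicate_Suc: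
  assumes "0 < N" "N \<le> K"
  shows "(\<Sum>s\<le>K. Y ^ s * chain_sum (replicate s g @ gs) (Suc N)) =
      (1 + Y * g N) * (\<Sum>s\<le>K. Y ^ s * chain_sum (replicate s g @ gs) N)
      + (chain_sum gs (Suc N) - chain_sum gs N)"
proof -
  obtain k where k: "K = Suc k" using assms by (cases K) auto
  \<comment> \<open>Removing a copy of \<open>g\<close> leaves a sum up to \<open>K - 1\<close>; as
    \<open>N \<le> K\<close>, its missing top term is zero.\<close>
  have z: "chain_sum (replicate K g @ gs) N = 0"
    using assms by (intro chain_sum_eq_0) auto
  have "(\<Sum>s\<le>K. Y ^ s * chain_sum (replicate s g @ gs) (Suc N)) =
      chain_sum gs (Suc N) + (\<Sum>s\<le>k. Y ^ Suc s * chain_sum (replicate (Suc s) g @ gs) N)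
      + Y * g N * (\<Sum>s\<le>k. Y ^ s * chain_sum (replicate s g @ gs) N)"
    unfolding k sum.atMost_Suc_shift using assms(1)
    by (simp add: chain_sum_Suc sum_distrib_left sum.distrib algebra_simps del: chain_sum.simps(2))
  also have "(\<Sum>s\<le>k. Y ^ s * chain_sum (replicate s g @ gs) N) =
      (\<Sum>s\<le>K. Y ^ s * chain_sum (replicate s g @ gs) N)"
    using z unfolding k by simp
  also have "(\<Sum>s\<le>k. Y ^ Suc s * chain_sum (replicate (Suc s) g @ gs) N) =
      (\<Sum>s\<le>K. Y ^ s * chain_sum (replicate s g @ gs) N) - chain_sum gs N"
    unfolding k sum.atMost_Suc_shift by simp
  finally show ?thesis by (simp add: algebra_simps)
qed

section \<open>Weights of even and odd entries and their generating functions\<close>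

definition even_wt :: "nat \<Rightarrow> rat" where
  "even_wt m = (if even m then 2 / of_nat m else 0)"

text \<open>
  Modulo \<open>p\<close> an odd \<open>m\<close> may be replaced by \<open>m - p\<close>; this makes the weights of the odd entries
  with exponent \<open>1\<close> equal to \<open>- 1/i\<close>, where \<open>i = (p - m)/2\<close>.
\<close>

definition odd_wt :: "nat \<Rightarrow> nat \<Rightarrow> nat \<Rightarrow> rat" where
  "odd_wt p k m = (if odd m then 2 / (of_nat m - of_nat p) ^ k else 0)"

definition mixed_word :: "nat \<Rightarrow> nat \<Rightarrow> nat \<Rightarrow> nat \<Rightarrow> (nat \<Rightarrow> rat) list" where
  "mixed_word p r s t =
     replicate t (odd_wt p 1) @ odd_wt p 2 # replicate s (odd_wt p 1) @ replicate r even_wt"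

text \<open>
  Generating functions of chains consisting of even entries, then odd entries, then an odd entry
  with exponent \<open>2\<close>, then odd entries. The truncation at \<open>K\<close> is harmless for \<open>K \<ge> N\<close>, as there are no
  chains of length \<open>N\<close> below \<open>N\<close>.
\<close>

definition gf0 :: "nat \<Rightarrow> rat \<Rightarrow> nat \<Rightarrow> rat" where
  "gf0 K u N = (\<Sum>r\<le>K. u ^ r * chain_sum (replicate r even_wt) N)"

definition gf1 :: "nat \<Rightarrow> nat \<Rightarrow> rat \<Rightarrow> rat \<Rightarrow> nat \<Rightarrow> rat" where
  "gf1 p K u X N = (\<Sum>r\<le>K. u ^ r *
     (\<Sum>s\<le>K. X ^ s * chain_sum (replicate s (odd_wt p 1) @ replicate r even_wt) N))"

definition gf2 :: "nat \<Rightarrow> nat \<Rightarrow> rat \<Rightarrow> rat \<Rightarrow> rat \<Rightarrow> nat \<Rightarrow> rat" where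
  "gf2 p K u X Y N = (\<Sum>r\<le>K. u ^ r * (\<Sum>s\<le>K. X ^ s *
     (\<Sum>t\<le>K. Y ^ t * chain_sum (mixed_word p r s t) N)))"

lemma gf0_Suc:
  "0 < N \<Longrightarrow> N \<le> K \<Longrightarrow> gf0 K u (Suc N) = (1 + u * even_wt N) * gf0 K u N"
  unfolding gf0_def using chain_sum_replicate_Suc[of N K u even_wt "[]"] by simp

text \<open>The additive term collects the chains with top entry \<open>N\<close> and no odd entry;
  in \<open>gf2_Suc\<close> it collects those where \<open>N\<close> is the entry with exponent
  2.\<close>

lemma gf1_Suc:
  "0 < N \<Longrightarrow> N \<le> K \<Longrightarrow> gf1 p K u X (Suc N) =
     (1 + X * odd_wt p 1 N) * gf1 p K u X N + (gf0 K u (Suc N) - gf0 K u N)"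
  unfolding gf1_def gf0_def
  by (simp add: chain_sum_replicate_Suc sum.distrib sum_subtractf distrib_left right_diff_distrib
      sum_distrib_left mult_ac)

lemma gf2_Suc:
  "0 < N \<Longrightarrow> N \<le> K \<Longrightarrow> gf2 p K u X Y (Suc N) =
     (1 + Y * odd_wt p 1 N) * gf2 p K u X Y N + odd_wt p 2 N * gf1 p K u X N"
  unfolding gf2_def gf1_def mixed_word_def
  by (simp add: chain_sum_replicate_Suc chain_sum_Suc sum.distrib distrib_left 
      sum_distrib_left mult_ac del: chain_sum.simps(2))

lemma sum_delta_power_0: "(\<Sum>r\<le>K. (u :: rat) ^ r * (if r = 0 then c else 0)) = c"
  by (induction K) auto

lemma gf_1:
  "gf0 K u (Suc 0) = 1" "gf1 p K u X (Suc 0) = 1" "gf2 p K u X Y (Suc 0) = 0"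
proof -
  show "gf0 K u (Suc 0) = 1"
    using sum_delta_power_0[where c = 1] by (simp add: gf0_def chain_sum_1)
  have "chain_sum (replicate s f @ replicate r g) (Suc 0) =
      (if s = 0 then if r = 0 then 1 else 0 else 0)" for s r f g
    by (simp add: chain_sum_1)
  thus "gf1 p K u X (Suc 0) = 1"
    by (simp add: gf1_def sum_delta_power_0 del: power_Suc mult_eq_0_iff)
  show "gf2 p K u X Y (Suc 0) = 0"
    by (simp add: gf2_def mixed_word_def chain_sum_1)
qed

text \<open>An even entry \<open>2 * i\<close> has weight \<open>1/i\<close>, so this is the product
  of \<open>1 + u/i\<close> over \<open>1 \<le> i \<le> k\<close>.\<close>

lemma gf0_odd:
  "2 * k < K \<Longrightarrow> gf0 K u (Suc (2 * k)) = multichoose (1 + u) k"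
proof (induction k)
  case 0
  show ?case by (simp add: gf_1)
next
  case (Suc k)
  have "gf0 K u (Suc (2 * Suc k)) = (1 + u / of_nat (Suc k)) * multichoose (1 + u) k"
    using Suc by (simp add: gf0_Suc even_wt_def field_simps)
  also have "\<dots> = multichoose (1 + u) (Suc k)"
    using multichoose_Suc[of k "1 + u"] by (simp add: field_simps)
  finally show ?case .
qed

lemma gf0_even: "2 * k < K \<Longrightarrow> gf0 K u (2 * Suc k) = gf0 K u (Suc (2 * k))"
  by (simp add: gf0_Suc even_wt_def)

lemma odd_wt_odd:
  assumes "k < q"
  shows "odd_wt (Suc (2 * q)) 1 (Suc (2 * k)) = - 1 / of_nat (q - k)"
    and "odd_wt (Suc (2 * q)) 2 (Suc (2 * k)) = 1 / (2 * of_nat (q - k) ^ 2)"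
proof -
  have eq: "of_nat (Suc (2 * k)) - of_nat (Suc (2 * q)) = (-2 * of_nat (q - k) :: rat)"
    using assms by (simp add: of_nat_diff)
  show "odd_wt (Suc (2 * q)) 1 (Suc (2 * k)) = - 1 / of_nat (q - k)"
    and "odd_wt (Suc (2 * q)) 2 (Suc (2 * k)) = 1 / (2 * of_nat (q - k) ^ 2)"
    unfolding odd_wt_def eq by (simp_all add: power2_eq_square)
qed

section \<open>The generating functions at odd arguments up to \<open>2 * q + 1\<close>\<close>

context
  fixes q K :: nat
  assumes K: "2 * q < K"
begin

text \<open>An odd step multiplies, then an even step adds the increment of \<open>gf0\<close>,
  which Pascal's rule evaluates. The odd entry \<open>m = 2 * k + 1\<close> has index
  \<open>(p - m)/2 = q - k\<close>.\<close>

lemma gf1_double: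
  assumes "k < q"
  shows "gf1 (Suc (2 * q)) K u X (Suc (2 * Suc k)) =
    (1 - X / of_nat (q - k)) * gf1 (Suc (2 * q)) K u X (Suc (2 * k)) + multichoose u (Suc k)"
proof -
  let ?p = "Suc (2 * q)"
  have even: "odd_wt ?p 1 (2 * Suc k) = 0"
    by (simp add: odd_wt_def)
  have mc: "multichoose (1 + u) (Suc k) - multichoose (1 + u) k = multichoose u (Suc k)"
  proof -
    have "of_nat (Suc k) * (multichoose (1 + u) (Suc k) - multichoose (1 + u) k) =
        of_nat (Suc k) * multichoose u (Suc k)"
      using multichoose_Suc[of k "1 + u"] multichoose_Suc'[of k u]
      by (simp add: algebra_simps)
    thus ?thesis by (metis mult_left_cancel of_nat_neq_0)
  qed
  have "gf1 ?p K u X (Suc (2 * Suc k)) = gf1 ?p K u X (2 * Suc k) + multichoose u (Suc k)"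
    using assms K gf1_Suc[of "2 * Suc k" K ?p u X] mc
    by (simp add: even[simplified] gf0_odd[of "Suc k", simplified] gf0_even[simplified] gf0_odd
        del: multichoose_0)
  also have "gf1 ?p K u X (2 * Suc k) = (1 - X / of_nat (q - k)) * gf1 ?p K u X (Suc (2 * k))"
    using assms K gf1_Suc[of "Suc (2 * k)" K ?p u X] gf0_even[of k K u] odd_wt_odd[OF assms]
    by simp
  finally show ?thesis .
qed

lemma gf2_double:
  assumes "k < q"
  shows "gf2 (Suc (2 * q)) K u X Y (Suc (2 * Suc k)) =
    (1 - Y / of_nat (q - k)) * gf2 (Suc (2 * q)) K u X Y (Suc (2 * k))
    + 1 / (2 * of_nat (q - k) ^ 2) * gf1 (Suc (2 * q)) K u X (Suc (2 * k))"
proof -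
  let ?p = "Suc (2 * q)"
  have even: "odd_wt ?p i (2 * Suc k) = 0" for i
    by (simp add: odd_wt_def)
  have "gf2 ?p K u X Y (Suc (2 * Suc k)) = gf2 ?p K u X Y (2 * Suc k)"
    using assms K gf2_Suc[of "2 * Suc k" K ?p u X Y] by (simp add: even[simplified])
  also have "\<dots> = (1 - Y / of_nat (q - k)) * gf2 ?p K u X Y (Suc (2 * k))
      + 1 / (2 * of_nat (q - k) ^ 2) * gf1 ?p K u X (Suc (2 * k))"
    using assms K gf2_Suc[of "Suc (2 * k)" K ?p u X Y] odd_wt_odd[OF assms] by simp
  finally show ?thesis .
qed

text \<open>Sort by the last even entry \<open>2 * l\<close> (\<open>l = 0\<close> if there is
  none). The even entries give \<open>multichoose u l\<close>; the odd entries above have indices up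
  to \<open>q - l\<close> and give the marked product. The factor \<open>2 * X\<close> turns the
  weight \<open>1/(2 * i^2)\<close> of the marked entry into \<open>X/i^2\<close>.\<close>

lemma gf2_diag:
  "2 * X * gf2 (Suc (2 * q)) K u X X (Suc (2 * q)) =
     (\<Sum>l\<le>q. multichoose u l * marked_prod X (q - l))"
proof -
  let ?g1 = "\<lambda>k. gf1 (Suc (2 * q)) K u X (Suc (2 * k))"
  let ?g2 = "\<lambda>k. gf2 (Suc (2 * q)) K u X X (Suc (2 * k))"
  define S where "S = (\<Sum>l\<le>q. multichoose u l * marked_prod X (q - l))"
  txt \<open>The left-hand side is independent of \<open>k\<close>; the claim compares \<open>k = 0\<close> and \<open>k = q\<close>.\<close>
  have "2 * X * ?g2 k * multichoose (1 - X) (q - k) + ?g1 k * marked_prod X (q - k)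
      + (\<Sum>l\<in>{k<..q}. multichoose u l * marked_prod X (q - l)) = S" if "k \<le> q" for k
    using that
  proof (induction k)
    case 0
    have "{..q} = insert 0 {0<..q}" by auto
    thus ?case by (simp add: gf_1 S_def)
  next
    case (Suc k)
    define r where "r = q - Suc k"
    have r: "q - k = Suc r" using Suc.prems by (simp add: r_def)
    define n :: rat where "n = of_nat (Suc r)"
    have "n \<noteq> 0" unfolding n_def by (rule of_nat_neq_0)
    have split: "{k<..q} = insert (Suc k) {Suc k<..q}" using Suc.prems by auto
    have "n * multichoose (1 - X) (Suc r) = (n - X) * multichoose (1 - X) r"
      using multichoose_Suc[of r "1 - X"] by (simp add: n_def algebra_simps)
    hence mc: "multichoose (1 - X) (Suc r) = (1 - X / n) * multichoose (1 - X) r"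
      using \<open>n \<noteq> 0\<close> by (simp add: field_simps)
    have mp: "marked_prod X (Suc r) =
        (1 - X / n) * marked_prod X r + X / n\<^sup>2 * multichoose (1 - X) r"
      by (simp add: n_def)
    have g1: "?g1 (Suc k) = (1 - X / n) * ?g1 k + multichoose u (Suc k)"
      using gf1_double[of k u X] Suc.prems unfolding r n_def by simp
    have g2: "?g2 (Suc k) = (1 - X / n) * ?g2 k + 1 / (2 * n\<^sup>2) * ?g1 k"
      using gf2_double[of k u X X] Suc.prems unfolding r n_def by simp
    have "2 * X * ?g2 k * multichoose (1 - X) (Suc r) + ?g1 k * marked_prod X (Suc r)
       + (multichoose u (Suc k) * marked_prod X r
       + (\<Sum>l\<in>{Suc k<..q}. multichoose u l * marked_prod X (q - l))) = S"
      using Suc.IH Suc.prems unfolding split by (simp add: r r_def)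
    thus ?case
      unfolding r_def[symmetric] g1 g2 mc mp
      using \<open>n \<noteq> 0\<close> by (simp add: algebra_simps)
  qed
  from this[of q] show ?thesis by (simp add: S_def)
qed

text \<open>Only odd entries remain. The index \<open>i = (p - m)/2\<close> reverses the order:
  entries below the one with exponent 2 have indices \<open>j > i\<close> and factors
  \<open>1 - B/j\<close>, those above have \<open>j < i\<close> and factors
  \<open>1 + v/j\<close>.\<close>

lemma gf2_split:
  "2 * v * gf2 (Suc (2 * q)) K 0 B (- v) (Suc (2 * q)) = split_prod B v q"
proof -
  let ?g1 = "\<lambda>k. gf1 (Suc (2 * q)) K 0 B (Suc (2 * k))"
  let ?g2 = "\<lambda>k. gf2 (Suc (2 * q)) K 0 B (- v) (Suc (2 * k))"
  \<comment> \<open>An invariant in \<open>k\<close>: the first term completes chains already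
    containing the entry with exponent 2, the second those still awaiting it.\<close>
  have "2 * v * ?g2 k * multichoose (v + 1) (q - k) + ?g1 k * split_prod B v (q - k)
      = split_prod B v q" if "k \<le> q" for k
    using that
  proof (induction k)
    case 0
    show ?case by (simp add: gf_1)
  next
    case (Suc k)
    define r where "r = q - Suc k"
    have r: "q - k = Suc r" using Suc.prems by (simp add: r_def)
    define n :: rat where "n = of_nat (Suc r)"
    have "n \<noteq> 0" unfolding n_def by (rule of_nat_neq_0)
    have "n * multichoose (v + 1) (Suc r) = (n + v) * multichoose (v + 1) r"
      using multichoose_Suc[of r "v + 1"] by (simp add: n_def algebra_simps)
    hence mc: "multichoose (v + 1) (Suc r) = (1 + v / n) * multichoose (v + 1) r"
      using \<open>n \<noteq> 0\<close> by (simp add: field_simps)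
    have mcv: "multichoose v (Suc r) = v * multichoose (v + 1) r / n"
      using multichoose_Suc'[of r v] \<open>n \<noteq> 0\<close> by (simp add: n_def field_simps)
    have sp: "split_prod B v (Suc r) =
        (1 - B / n) * split_prod B v r + v / n\<^sup>2 * multichoose (v + 1) r"
      by (simp add: mcv power2_eq_square n_def del: of_nat_Suc)
    have g1: "?g1 (Suc k) = (1 - B / n) * ?g1 k"
      using gf1_double[of k 0 B] Suc.prems unfolding r n_def by (simp add: multichoose_zero_Suc)
    have g2: "?g2 (Suc k) = (1 + v / n) * ?g2 k + 1 / (2 * n\<^sup>2) * ?g1 k"
      using gf2_double[of k 0 B "- v"] Suc.prems unfolding r n_def by simp
    have "2 * v * ?g2 k * multichoose (v + 1) (Suc r) + ?g1 k * split_prod B v (Suc r)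
       = split_prod B v q"
      using Suc.IH Suc.prems by (simp add: r)
    thus ?case
      unfolding r_def[symmetric] g1 g2 mc sp
      using \<open>n \<noteq> 0\<close> by (simp add: algebra_simps)
  qed
  from this[of q] show ?thesis by simp
qed

text \<open>Doubled, the three terms are evaluated by \<open>gf2_diag\<close> and
  \<open>gf2_split\<close>, and \<open>sum_multichoose_marked_prod\<close> relates them.\<close>

lemma gf2_identity:
  "(B + u) * gf2 (Suc (2 * q)) K u (B + u) (B + u) (Suc (2 * q)) =
     B * gf2 (Suc (2 * q)) K 0 B B (Suc (2 * q)) +
     u * gf2 (Suc (2 * q)) K 0 B (- u) (Suc (2 * q))"
proof -
  have "(\<Sum>l\<le>q. multichoose 0 l * marked_prod B (q - l)) = marked_prod B q"
    using sum_multichoose_marked_prod[of 0 B q]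
    by (cases q) (simp_all add: sum.atMost_Suc_shift multichoose_zero_Suc del: sum.atMost_Suc)
  thus ?thesis
    using gf2_diag[where u = u and X = "B + u"] gf2_diag[where u = 0 and X = B]
      gf2_split[where v = u and B = B]
      sum_multichoose_marked_prod[of u B q]
    by (simp add: algebra_simps)
qed

end

section \<open>Comparison of coefficients\<close>

text \<open>Polynomials over an infinite field that agree off one point are equal. The exceptional
  point \<open>c\<close> allows for a cancelled factor \<open>1 + x\<close>.\<close>

lemma sum_power_eq_imp_sum_eq:
  fixes f :: "'a \<Rightarrow> rat" and g :: "'b \<Rightarrow> rat"
  assumes "finite I" "finite J"
    and eq: "\<And>x. x \<noteq> c \<Longrightarrow> (\<Sum>i\<in>I. x ^ d i * f i) = (\<Sum>j\<in>J. x ^ e j * g j)"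
  shows "(\<Sum>i | i \<in> I \<and> d i = n. f i) = (\<Sum>j | j \<in> J \<and> e j = n. g j)"
proof -
  define P where "P = (\<Sum>i\<in>I. Polynomial.monom (f i) (d i))"
  define Q where "Q = (\<Sum>j\<in>J. Polynomial.monom (g j) (e j))"
  have "P = Q"
  proof (rule ccontr)
    assume "P \<noteq> Q"
    hence "finite {x. poly (P - Q) x = 0}"
      by (intro poly_roots_finite) simp
    moreover have "- {c} \<subseteq> {x. poly (P - Q) x = 0}"
      using eq by (auto simp: P_def Q_def poly_sum poly_monom mult.commute)
    moreover have "infinite (- {c})"
      using infinite_UNIV_char_0[where 'a = rat] by (simp add: Compl_eq_Diff_UNIV)
    ultimately show False
      by (meson finite_subset)
  qed
  have "coeff P n = (\<Sum>i | i \<in> I \<and> d i = n. f i)"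
    unfolding P_def coeff_sum Polynomial.coeff_monom
    using \<open>finite I\<close> by (simp add: sum.inter_filter)
  moreover have "coeff Q n = (\<Sum>j | j \<in> J \<and> e j = n. g j)"
    unfolding Q_def coeff_sum Polynomial.coeff_monom
    using \<open>finite J\<close> by (simp add: sum.inter_filter)
  ultimately show ?thesis
    using \<open>P = Q\<close> by simp
qed

lemma gf2_eq_sum:
  "gf2 p K u X Y N = (\<Sum>(r, s, t)\<in>{..K} \<times> {..K} \<times> {..K}.
     u ^ r * (X ^ s * (Y ^ t * chain_sum (mixed_word p r s t) N)))"
  by (simp add: gf2_def sum_distrib_left sum.cartesian_product case_prod_unfold)

lemma gf2_0_eq_sum:
  "gf2 p K 0 X Y N = (\<Sum>(s, t)\<in>{..K} \<times> {..K}.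
     X ^ s * (Y ^ t * chain_sum (mixed_word p 0 s t) N))"
proof -
  \<comment> \<open>As \<open>0 ^ 0 = 1\<close>, the term \<open>r = 0\<close> survives.\<close>
  have "(\<Sum>r\<le>K. 0 ^ r * f r) = f 0" for f :: "nat \<Rightarrow> rat"
    by (induction K) auto
  hence "gf2 p K 0 X Y N = (\<Sum>s\<le>K. X ^ s * (\<Sum>t\<le>K. Y ^ t * chain_sum (mixed_word p 0 s t) N))"
    unfolding gf2_def .
  thus ?thesis
    by (simp add: sum_distrib_left sum.cartesian_product)
qed

text \<open>
  The coefficient of \<open>u ^ (a + 2)\<close> in the identity between generating functions, with \<open>B = x * u\<close>.
\<close>

lemma sum_chain_sum_mixed_word:
  fixes x :: rat and q a :: nat
  defines "M \<equiv> \<lambda>r s t. chain_sum (mixed_word (Suc (2 * q)) r s t) (Suc (2 * q))"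
  shows "(\<Sum>i\<le>a + 1. (1 + x) ^ (i + 1) * (\<Sum>j\<le>i. M (a + 1 - i) (i - j) j)) =
    (\<Sum>j\<le>a + 1. (x ^ (a + 2) + x ^ j * (- 1) ^ (a + 1 - j)) * M 0 j (a + 1 - j))"
proof -
  \<comment> \<open>Large enough for \<open>gf2_identity\<close> and for all exponents with
    \<open>r + s + t = a + 1\<close>.\<close>
  define K where "K = 2 * q + a + 2"
  define I where "I = {..K} \<times> {..K} \<times> {..K}"
  define J where "J = {..K} \<times> {..K}"
  \<comment> \<open>The extra 1 in both degrees comes from the outer factors \<open>B + u\<close>,
    \<open>B\<close> and \<open>u\<close>, all multiples of \<open>u\<close>.\<close>
  let ?d = "\<lambda>(r, s, t). r + s + t + 1" and ?e = "\<lambda>(s, t). s + t + 1"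
  let ?f = "\<lambda>(r, s, t). (1 + x) ^ (s + t + 1) * M r s t"
  let ?g = "\<lambda>(s, t). (x ^ (s + t + 1) + x ^ s * (- 1) ^ t) * M 0 s t"
  have gf: "(\<Sum>i\<in>I. u ^ ?d i * ?f i) = (\<Sum>j\<in>J. u ^ ?e j * ?g j)" for u
  proof -
    have "(\<Sum>i\<in>I. u ^ ?d i * ?f i) =
        (x * u + u) * gf2 (Suc (2 * q)) K u (x * u + u) (x * u + u) (Suc (2 * q))"
    proof -
      have "x * u + u = (1 + x) * u" by (simp add: algebra_simps)
      thus ?thesis
        unfolding gf2_eq_sum I_def sum_distrib_left M_def
        by (intro sum.cong refl) (auto simp: power_mult_distrib power_add mult_ac)
    qed
    also have "\<dots> = x * u * gf2 (Suc (2 * q)) K 0 (x * u) (x * u) (Suc (2 * q)) +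
        u * gf2 (Suc (2 * q)) K 0 (x * u) (- u) (Suc (2 * q))"
      by (rule gf2_identity) (simp add: K_def)
    also have "\<dots> = (\<Sum>j\<in>J. u ^ ?e j * ?g j)"
      unfolding gf2_0_eq_sum J_def sum_distrib_left M_def sum.distrib[symmetric]
      by (intro sum.cong refl)
         (auto simp: power_mult_distrib power_add power_minus[of u] algebra_simps)
    finally show ?thesis .
  qed
  have eq: "s + t = Suc a \<longleftrightarrow> s \<le> Suc a \<and> t = Suc a - s" for s t
    by auto
  have "(\<Sum>i\<le>a + 1. (1 + x) ^ (i + 1) * (\<Sum>j\<le>i. M (a + 1 - i) (i - j) j)) =
      (\<Sum>(i, j)\<in>Sigma {..a + 1} (\<lambda>i. {..i}). (1 + x) ^ (i + 1) * M (a + 1 - i) (i - j) j)"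
    by (simp add: sum.Sigma sum_distrib_left del: sum.atMost_Suc)
  also have "\<dots> = (\<Sum>i | i \<in> I \<and> ?d i = a + 2. ?f i)"
    by (intro sum.reindex_bij_witness[of _ "\<lambda>(r, s, t). (s + t, t)"
        "\<lambda>(i, j). (a + 1 - i, i - j, j)"])
       (auto simp: I_def K_def)
  also have "\<dots> = (\<Sum>j | j \<in> J \<and> ?e j = a + 2. ?g j)"
    by (rule sum_power_eq_imp_sum_eq[where c = 0, OF _ _ gf]) (simp_all add: I_def J_def)
  also have "\<dots> = (\<Sum>j\<le>a + 1. (x ^ (a + 2) + x ^ j * (- 1) ^ (a + 1 - j)) * M 0 j (a + 1 - j))"
    by (intro sum.reindex_bij_witness[of _ "\<lambda>j. (j, a + 1 - j)" "\<lambda>(s, t). s"])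
       (auto simp: J_def K_def eq)
  finally show ?thesis .
qed

text \<open>On multiplying out, neighbouring partial sums on the left differ by a single
  \<open>T s\<close>. Read backwards this is a division by \<open>1 + x\<close>; it produces the
  partial sum and the sign \<open>(- 1) ^ m\<close> of the theorem.\<close>

lemma alternating_partial_sums:
  fixes x :: rat and T :: "nat \<Rightarrow> rat"
  shows "(1 + x) * (\<Sum>s\<le>a. x ^ s * ((- 1) ^ (a - s) * (\<Sum>j\<le>s. T j))) =
    (\<Sum>j\<le>a + 1. (x ^ (a + 1) - x ^ j * (- 1) ^ (a + 1 - j)) * T j)"
proof (induction a)
  case 0
  show ?case by (simp add: algebra_simps)
next
  case (Suc a)
  have "(\<Sum>s\<le>Suc a. x ^ s * ((- 1) ^ (Suc a - s) * (\<Sum>j\<le>s. T j))) =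
      - (\<Sum>s\<le>a. x ^ s * ((- 1) ^ (a - s) * (\<Sum>j\<le>s. T j))) + x ^ Suc a * (\<Sum>j\<le>Suc a. T j)"
    by (simp add: Suc_diff_le flip: sum_negf)
  hence "(1 + x) * (\<Sum>s\<le>Suc a. x ^ s * ((- 1) ^ (Suc a - s) * (\<Sum>j\<le>s. T j))) =
      - (\<Sum>j\<le>a + 1. (x ^ (a + 1) - x ^ j * (- 1) ^ (a + 1 - j)) * T j)
      + (1 + x) * x ^ Suc a * (\<Sum>j\<le>Suc a. T j)"
    by (simp only: Suc.IH[symmetric]) (simp add: algebra_simps)
  also have "\<dots> = (\<Sum>j\<le>a + 1. (x ^ (a + 2) - x ^ j * (- 1) ^ (a + 2 - j)) * T j)"
    unfolding sum_negf[symmetric] sum_distrib_left Suc_eq_plus1 sum.distrib[symmetric]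
    by (intro sum.cong refl) (simp add: Suc_diff_le algebra_simps)
  also have "\<dots> = (\<Sum>j\<le>Suc a + 1. (x ^ (Suc a + 1) - x ^ j * (- 1) ^ (Suc a + 1 - j)) * T j)"
    by simp
  finally show ?case .
qed

lemma mixed_word_identity:
  fixes q a m :: nat
  defines "M \<equiv> \<lambda>r s t. chain_sum (mixed_word (Suc (2 * q)) r s t) (Suc (2 * q))"
  assumes "m \<le> a"
  shows "of_nat ((a + 1) choose (m + 1)) * (\<Sum>j = 0..a + 1. M 0 j (a + 1 - j)) +
      (- 1) ^ m * (\<Sum>j = 0..a - m. M 0 j (a + 1 - j)) =
    - (\<Sum>i = 0..a. \<Sum>j = 0..i. of_nat (i choose (a - m)) * M (a + 1 - i) (i - j) j)"
proof -
  define T where "T = (\<lambda>j. M 0 j (a + 1 - j))"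
  define W where "W = (\<lambda>i. \<Sum>j\<le>i. M (a + 1 - i) (i - j) j)"
  define total where "total = (\<Sum>j\<le>a + 1. T j)"
  \<comment> \<open>With \<open>r = 0\<close> there are no even entries, so the top coefficient is
    the full sum of the \<open>t\<close>-type words.\<close>
  have W_last: "W (a + 1) = total"
    unfolding W_def T_def total_def
    by (rule sum.reindex_bij_witness[of _ "\<lambda>j. a + 1 - j" "\<lambda>j. a + 1 - j"]) auto
  let ?f = "\<lambda>s. \<Sum>i\<le>a. of_nat (i choose s) * W i"
  let ?g = "\<lambda>s. - (of_nat ((a + 1) choose s) * total + (- 1) ^ (a - s) * (\<Sum>j\<le>s. T j))"
  have "(\<Sum>s\<le>a. x ^ s * ?f s) = (\<Sum>s\<le>a. x ^ s * ?g s)" if "x \<noteq> - 1" for x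
  proof -
    have binom: "(1 + x) ^ i = (\<Sum>s\<le>i. of_nat (i choose s) * x ^ s)" for i
      using binomial_ring[of x 1 i] by (simp add: add.commute)
    have binom': "(1 + x) ^ i = (\<Sum>s\<le>a. of_nat (i choose s) * x ^ s)" if "i \<le> a" for i
      unfolding binom using that by (intro sum.mono_neutral_left) auto
    have "(\<Sum>s\<le>a. x ^ s * ?f s) = (\<Sum>i\<le>a. (1 + x) ^ i * W i)"
      unfolding sum_distrib_left
      by (subst sum.swap, intro sum.cong refl)
         (simp add: binom' sum_distrib_left sum_distrib_right mult_ac)
    hence "(1 + x) * (\<Sum>s\<le>a. x ^ s * ?f s) = (\<Sum>i\<le>a. (1 + x) ^ (i + 1) * W i)"
      by (simp add: sum_distrib_left mult.assoc)
    also have "\<dots> = (\<Sum>j\<le>a + 1. (x ^ (a + 2) + x ^ j * (- 1) ^ (a + 1 - j)) * T j)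
        - (1 + x) ^ (a + 2) * total"
      using sum_chain_sum_mixed_word[where x = x and a = a and q = q] W_last
      by (simp add: W_def T_def M_def)
    \<comment> \<open>Adding and subtracting \<open>x ^ (a + 1) * total\<close> makes every part
      divisible by \<open>1 + x\<close>.\<close>
    also have "\<dots> = x ^ (a + 2) * total + x ^ (a + 1) * total - (1 + x) ^ (a + 2) * total
        - (\<Sum>j\<le>a + 1. (x ^ (a + 1) - x ^ j * (- 1) ^ (a + 1 - j)) * T j)"
      unfolding total_def sum_distrib_left
      by (simp add: left_diff_distrib distrib_right sum.distrib sum_subtractf)
    also have "\<dots> = - (1 + x) * (((1 + x) ^ (a + 1) - x ^ (a + 1)) * total
        + (\<Sum>s\<le>a. x ^ s * ((- 1) ^ (a - s) * (\<Sum>j\<le>s. T j))))"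
      unfolding alternating_partial_sums[symmetric] by (simp add: algebra_simps)
    \<comment> \<open>The leading powers cancel, leaving degree at most \<open>a\<close>.\<close>
    also have "(1 + x) ^ (a + 1) - x ^ (a + 1) = (\<Sum>s\<le>a. of_nat ((a + 1) choose s) * x ^ s)"
      unfolding binom[of "a + 1"] by simp
    also have "- (1 + x) * ((\<Sum>s\<le>a. of_nat ((a + 1) choose s) * x ^ s) * total
        + (\<Sum>s\<le>a. x ^ s * ((- 1) ^ (a - s) * (\<Sum>j\<le>s. T j)))) =
        (1 + x) * (\<Sum>s\<le>a. x ^ s * ?g s)"
      by (simp only: sum_distrib_right sum.distrib[symmetric] mult_minus_left mult_minus_right
          sum_negf) (simp add: algebra_simps)
    finally show ?thesis
      using that by (simp add: add_eq_0_iff2)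
  qed
  from sum_power_eq_imp_sum_eq[OF _ _ this, where n = "a - m"]
  have "(\<Sum>s | s \<in> {..a} \<and> s = a - m. ?f s) = (\<Sum>s | s \<in> {..a} \<and> s = a - m. ?g s)"
    by simp
  moreover have "{s. s \<in> {..a} \<and> s = a - m} = {a - m}"
    by auto
  ultimately have "?f (a - m) = ?g (a - m)"
    by (simp only:) simp
  moreover have "(a + 1) choose (a - m) = (a + 1) choose (m + 1)"
    using binomial_symmetric[of "m + 1" "a + 1"] \<open>m \<le> a\<close> by simp
  ultimately have "of_nat ((a + 1) choose (m + 1)) * total + (- 1) ^ m * (\<Sum>j\<le>a - m. T j) =
      - (\<Sum>i\<le>a. of_nat (i choose (a - m)) * W i)"
    using \<open>m \<le> a\<close> by simp
  thus ?thesis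
    by (simp add: total_def T_def W_def sum_distrib_left atMost_atLeast0)
qed

section \<open>Reduction modulo a prime\<close>

text \<open>For prime \<open>p\<close>, the localization of the integers at \<open>p\<close>; the
  fraction need not be reduced.\<close>

definition p_integral :: "nat \<Rightarrow> rat \<Rightarrow> bool" where
  "p_integral p x \<longleftrightarrow> (\<exists>a b. x = of_int a / of_int b \<and> b \<noteq> 0 \<and> coprime b (int p))"

lemma p_integralE:
  assumes "p_integral p x"
  obtains a b where "x = of_int a / of_int b" "b \<noteq> 0" "coprime b (int p)"
  using assms by (auto simp: p_integral_def)

text \<open>The reduced denominator \<open>d\<close> divides \<open>b\<close>, so it is invertible
  modulo \<open>p\<close> and can be cancelled after cross-multiplication.\<close>

lemma cong_rat_mod:
  assumes "b \<noteq> 0" "coprime b (int p)"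
  shows "[rat_mod p (of_int a / of_int b) * b = a] (mod int p)"
proof -
  obtain n d where nd: "quotient_of (of_int a / of_int b) = (n, d)"
    by (cases "quotient_of (of_int a / of_int b)")
  have "of_int a / of_int b = (of_int n / of_int d :: rat)"
    using quotient_of_div[OF nd] .
  moreover have "d > 0"
    using quotient_of_denom_pos[OF nd] .
  ultimately have "of_int (a * d) = (of_int (n * b) :: rat)"
    using assms(1) by (simp add: field_simps)
  hence eq: "a * d = n * b"
    by (simp only: of_int_eq_iff)
  have "d dvd n * b"
    by (metis dvd_triv_right eq)
  hence "d dvd b"
    using quotient_of_coprime[OF nd] by (simp add: coprime_commute coprime_dvd_mult_right_iff)
  hence d: "coprime d (int p)"
    using assms(2) by (metis coprime_divisors dvd_refl)
  have "[rat_mod p (of_int a / of_int b) * b * d = n * modular_inverse (int p) d * b * d] (mod int p)"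
    by (auto simp: rat_mod_def nd intro!: cong_mult)
  also have "n * modular_inverse (int p) d * b * d = n * b * (modular_inverse (int p) d * d)"
    by (simp add: mult_ac)
  also have "[n * b * (modular_inverse (int p) d * d) = n * b * 1] (mod int p)"
    by (intro cong_mult cong_refl cong_modular_inverse2 d)
  finally show ?thesis
    using d by (simp add: eq[symmetric] cong_mult_rcancel)
qed

lemma rat_mod_of_int: "[rat_mod p (of_int a) = a] (mod int p)"
  using cong_rat_mod[of 1 p a] by simp

lemma rat_mod_add:
  assumes "p_integral p x" "p_integral p y"
  shows "p_integral p (x + y)" "[rat_mod p (x + y) = rat_mod p x + rat_mod p y] (mod int p)"
proof -
  obtain a b where x: "x = of_int a / of_int b" and b: "b \<noteq> 0" "coprime b (int p)"
    using assms(1) by (rule p_integralE)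
  obtain c d where y: "y = of_int c / of_int d" and d: "d \<noteq> 0" "coprime d (int p)"
    using assms(2) by (rule p_integralE)
  have xy: "x + y = of_int (a * d + c * b) / of_int (b * d)" and bd: "b * d \<noteq> 0" "coprime (b * d) (int p)"
    using b d by (simp_all add: x y field_simps)
  thus "p_integral p (x + y)"
    unfolding p_integral_def by blast
  have "[(rat_mod p x * b) * d + (rat_mod p y * d) * b = a * d + c * b] (mod int p)"
    unfolding x y by (intro cong_add cong_mult cong_rat_mod b d cong_refl)
  also have "[a * d + c * b = rat_mod p (x + y) * (b * d)] (mod int p)"
    unfolding xy by (rule cong_sym, rule cong_rat_mod) (use bd in auto)
  finally have "[rat_mod p (x + y) * (b * d) = (rat_mod p x + rat_mod p y) * (b * d)] (mod int p)"
    by (simp add: algebra_simps cong_sym_eq)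
  thus "[rat_mod p (x + y) = rat_mod p x + rat_mod p y] (mod int p)"
    using bd(2) by (simp only: cong_mult_rcancel)
qed

lemma rat_mod_mult:
  assumes "p_integral p x" "p_integral p y"
  shows "p_integral p (x * y)" "[rat_mod p (x * y) = rat_mod p x * rat_mod p y] (mod int p)"
proof -
  obtain a b where x: "x = of_int a / of_int b" and b: "b \<noteq> 0" "coprime b (int p)"
    using assms(1) by (rule p_integralE)
  obtain c d where y: "y = of_int c / of_int d" and d: "d \<noteq> 0" "coprime d (int p)"
    using assms(2) by (rule p_integralE)
  have xy: "x * y = of_int (a * c) / of_int (b * d)" and bd: "b * d \<noteq> 0" "coprime (b * d) (int p)"
    using b d by (simp_all add: x y field_simps)
  thus "p_integral p (x * y)"
    unfolding p_integral_def by blast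
  have "[(rat_mod p x * b) * (rat_mod p y * d) = a * c] (mod int p)"
    unfolding x y by (intro cong_mult cong_rat_mod b d cong_refl)
  also have "[a * c = rat_mod p (x * y) * (b * d)] (mod int p)"
    unfolding xy by (rule cong_sym, rule cong_rat_mod) (use bd in auto)
  finally have "[rat_mod p (x * y) * (b * d) = (rat_mod p x * rat_mod p y) * (b * d)] (mod int p)"
    by (simp add: mult_ac cong_sym_eq)
  thus "[rat_mod p (x * y) = rat_mod p x * rat_mod p y] (mod int p)"
    using bd(2) by (simp only: cong_mult_rcancel)
qed

lemma p_integral_of_int: "p_integral p (of_int a)"
  unfolding p_integral_def by (rule exI[of _ a], rule exI[of _ 1]) simp

text \<open>Integrality is built in, which makes the relation compatible with sums and
  products.\<close>

definition rat_cong :: "nat \<Rightarrow> rat \<Rightarrow> rat \<Rightarrow> bool" where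
  "rat_cong p x y \<longleftrightarrow> p_integral p x \<and> p_integral p y \<and> [rat_mod p x = rat_mod p y] (mod int p)"

lemma rat_cong_add:
  "rat_cong p x x' \<Longrightarrow> rat_cong p y y' \<Longrightarrow> rat_cong p (x + y) (x' + y')"
  unfolding rat_cong_def by (meson rat_mod_add cong_add cong_trans cong_sym)

lemma rat_cong_mult:
  "rat_cong p x x' \<Longrightarrow> rat_cong p y y' \<Longrightarrow> rat_cong p (x * y) (x' * y')"
  unfolding rat_cong_def by (meson rat_mod_mult cong_mult cong_trans cong_sym)

lemma rat_cong_of_int: "[a = b] (mod int p) \<Longrightarrow> rat_cong p (of_int a) (of_int b)"
  unfolding rat_cong_def by (meson p_integral_of_int rat_mod_of_int cong_trans cong_sym)

lemma rat_cong_inverse: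
  assumes "[a = b] (mod int p)" "coprime a (int p)" "prime p"
  shows "rat_cong p (1 / of_int a) (1 / of_int b)"
proof -
  have b: "coprime b (int p)"
    using assms by (metis cong_imp_coprime cong_def)
  have nz: "a \<noteq> 0" "b \<noteq> 0"
    using assms(2,3) b by (auto dest: prime_gt_1_nat)
  have "[rat_mod p (1 / of_int a) * b = rat_mod p (1 / of_int a) * a] (mod int p)"
    using assms(1) by (intro cong_mult cong_refl) (rule cong_sym)
  also have "[rat_mod p (1 / of_int a) * a = 1] (mod int p)"
    using cong_rat_mod[of a p 1] nz assms by simp
  also have "[1 = rat_mod p (1 / of_int b) * b] (mod int p)"
    using cong_rat_mod[of b p 1] nz b by (simp add: cong_sym_eq)
  finally have "[rat_mod p (1 / of_int a) = rat_mod p (1 / of_int b)] (mod int p)"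
    using b by (simp only: cong_mult_rcancel)
  moreover have "p_integral p (1 / of_int c)" if "c \<noteq> 0" "coprime c (int p)" for c
    unfolding p_integral_def using that by (intro exI[of _ 1] exI[of _ c]) simp
  ultimately show ?thesis
    using nz b assms(2) by (simp add: rat_cong_def)
qed

lemma rat_cong_power: "rat_cong p x y \<Longrightarrow> rat_cong p (x ^ k) (y ^ k)"
  using rat_cong_of_int[of 1 1 p] by (induction k) (simp_all add: rat_cong_mult)

lemma rat_cong_sum:
  "(\<And>i. i \<in> I \<Longrightarrow> rat_cong p (f i) (g i)) \<Longrightarrow> rat_cong p (sum f I) (sum g I)"
  using rat_cong_of_int[of 0 0 p]
  by (induction I rule: infinite_finite_induct) (simp_all add: rat_cong_add)

lemma rat_cong_chain_sum:
  assumes "list_all2 (\<lambda>f g. \<forall>m. 0 < m \<longrightarrow> m < p \<longrightarrow> rat_cong p (f m) (g m)) fs gs" "N \<le> p"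
  shows "rat_cong p (chain_sum fs N) (chain_sum gs N)"
  using assms
proof (induction arbitrary: N rule: list_all2_induct)
  case Nil
  show ?case using rat_cong_of_int[of 1 1 p] by simp
next
  case (Cons f fs g gs)
  thus ?case by (auto intro!: rat_cong_sum rat_cong_mult)
qed

section \<open>Mixed sums as chain sums, and the shift of odd denominators\<close>

definition mixed_term :: "nat \<times> int \<Rightarrow> nat \<Rightarrow> rat" where
  "mixed_term = (\<lambda>(k, e) m. (1 + of_int e * (- 1) ^ m) / of_nat m ^ k)"

definition increasing_lists :: "nat \<Rightarrow> nat \<Rightarrow> nat list set" where
  "increasing_lists n N =
     {ms. length ms = n \<and> sorted_wrt (<) ms \<and> (\<forall>m\<in>set ms. 0 < m \<and> m < N)}"

lemma finite_increasing_lists: "finite (increasing_lists n N)"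
  by (rule finite_subset[OF _ finite_lists_length_eq[of "{..<N}" n]])
     (auto simp: increasing_lists_def)

text \<open>Splitting off the last, largest entry matches the recursion of \<open>chain_sum\<close>,
  which reads weights from the largest entry down; hence \<open>rev\<close>.\<close>

lemma sum_increasing_lists:
  "(\<Sum>ms\<in>increasing_lists (length gs) N. \<Prod>i<length gs. (gs ! i) (ms ! i)) = chain_sum (rev gs) N"
proof (induction gs arbitrary: N rule: rev_induct)
  case Nil
  have "increasing_lists 0 N = {[]}" by (auto simp: increasing_lists_def)
  thus ?case by simp
next
  case (snoc g gs)
  let ?n = "length gs"
  have "chain_sum (rev (gs @ [g])) N =
      (\<Sum>m\<in>{0<..<N}. g m * (\<Sum>ms\<in>increasing_lists ?n m. \<Prod>i<?n. (gs ! i) (ms ! i)))"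
    by (simp add: snoc.IH)
  also have "\<dots> = (\<Sum>(m, ms)\<in>Sigma {0<..<N} (increasing_lists ?n).
      g m * (\<Prod>i<?n. (gs ! i) (ms ! i)))"
    by (simp add: sum.Sigma finite_increasing_lists sum_distrib_left)
  also have "\<dots> = (\<Sum>ms\<in>increasing_lists (length (gs @ [g])) N.
      \<Prod>i<length (gs @ [g]). ((gs @ [g]) ! i) (ms ! i))"
  proof (rule sum.reindex_bij_witness[of _ "\<lambda>ms. (last ms, butlast ms)" "\<lambda>(m, ms). ms @ [m]"])
    fix ms assume ms: "ms \<in> increasing_lists (length (gs @ [g])) N"
    then obtain m ms' where "ms = ms' @ [m]"
      by (cases ms rule: rev_cases) (auto simp: increasing_lists_def)
    with ms show "(case (last ms, butlast ms) of (m, ms) \<Rightarrow> ms @ [m]) = ms"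
      and "(last ms, butlast ms) \<in> Sigma {0<..<N} (increasing_lists ?n)"
      by (auto simp: increasing_lists_def sorted_wrt_append)
  next
    fix z assume z: "z \<in> Sigma {0<..<N} (increasing_lists ?n)"
    obtain m ms where [simp]: "z = (m, ms)" by (cases z)
    show "(last (case z of (m, ms) \<Rightarrow> ms @ [m]), butlast (case z of (m, ms) \<Rightarrow> ms @ [m])) = z"
      by simp
    show "(case z of (m, ms) \<Rightarrow> ms @ [m]) \<in> increasing_lists (length (gs @ [g])) N"
      using z by (fastforce simp: increasing_lists_def sorted_wrt_append)
    have "length ms = ?n" using z by (simp add: increasing_lists_def)
    thus "(\<Prod>i<length (gs @ [g]). ((gs @ [g]) ! i) ((case z of (m, ms) \<Rightarrow> ms @ [m]) ! i)) =
        (case z of (m, ms) \<Rightarrow> g m * (\<Prod>i<?n. (gs ! i) (ms ! i)))"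
      by (simp add: nth_append mult.commute)
  qed
  finally show ?case ..
qed

lemma mixed_sum_eq_chain_sum:
  assumes "length ks = length es"
  shows "mixed_sum N ks es = chain_sum (rev (map mixed_term (zip ks es))) N"
proof -
  have "mixed_sum N ks es = (\<Sum>ms\<in>increasing_lists (length (map mixed_term (zip ks es))) N.
      \<Prod>i<length (map mixed_term (zip ks es)). (map mixed_term (zip ks es) ! i) (ms ! i))"
    using assms
    by (simp add: mixed_sum_def increasing_lists_def mixed_term_def prod_dividef)
  thus ?thesis
    by (simp only: sum_increasing_lists)
qed

text \<open>Only the denominator is shifted: the sign stays at \<open>m\<close>, because
  \<open>m - p\<close> has the other parity for odd \<open>p\<close>.\<close>

definition shifted_term :: "nat \<Rightarrow> nat \<times> int \<Rightarrow> nat \<Rightarrow> rat" where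
  "shifted_term p = (\<lambda>(k, e) m.
     (1 + of_int e * (- 1) ^ m) / (if odd m then of_nat m - of_nat p else of_nat m) ^ k)"

lemma rat_cong_mixed_term:
  assumes "prime p" "0 < m" "m < p"
  shows "rat_cong p (mixed_term ke m) (shifted_term p ke m)"
proof -
  obtain k e where [simp]: "ke = (k, e)" by (cases ke)
  define w where "w = (if odd m then int m - int p else int m)"
  have "coprime m p"
    using assms by (metis coprime_commute nat_dvd_not_less prime_imp_coprime)
  hence m: "coprime (int m) (int p)"
    by simp
  have w: "[int m = w] (mod int p)"
    by (simp add: w_def cong_iff_dvd_diff)
  have "rat_cong p (of_int (1 + e * (- 1) ^ m) * (1 / of_int (int m)) ^ k)
      (of_int (1 + e * (- 1) ^ m) * (1 / of_int w) ^ k)"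
    by (intro rat_cong_mult rat_cong_power rat_cong_inverse rat_cong_of_int cong_refl w m assms(1))
  also have "of_int (1 + e * (- 1) ^ m) * (1 / of_int (int m)) ^ k = mixed_term ke m"
    by (simp add: mixed_term_def power_divide)
  also have "of_int (1 + e * (- 1) ^ m) * (1 / of_int w) ^ k = shifted_term p ke m"
    by (simp add: shifted_term_def w_def power_divide)
  finally show ?thesis .
qed

lemma shifted_term_eq:
  "shifted_term p (1, 1) = even_wt" "shifted_term p (k, -1) = odd_wt p k"
  by (auto simp: fun_eq_iff shifted_term_def even_wt_def odd_wt_def)

lemma rat_cong_mixed_sum:
  assumes "prime p" "length ks = length es"
  shows "rat_cong p (mixed_sum p ks es) (chain_sum (rev (map (shifted_term p) (zip ks es))) p)"
proof -
  have "list_all2 (\<lambda>f g. \<forall>m. 0 < m \<longrightarrow> m < p \<longrightarrow> rat_cong p (f m) (g m))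
      (rev (map mixed_term (zip ks es))) (rev (map (shifted_term p) (zip ks es)))"
    using assms(1) by (simp add: list.rel_map list_all2_same rat_cong_mixed_term)
  from rat_cong_chain_sum[OF this order.refl] show ?thesis
    by (simp only: mixed_sum_eq_chain_sum[OF assms(2)])
qed

lemma rat_cong_mixed_word:
  assumes "prime p"
  shows "rat_cong p
    (mixed_sum p (replicate (r + s) 1 @ [2] @ replicate t 1)
       (replicate r 1 @ replicate (s + t + 1) (-1)))
    (chain_sum (mixed_word p r s t) p)"
proof -
  \<comment> \<open>This cuts the sign string at the entry with exponent 2.\<close>
  have eq: "s + t + 1 = s + Suc t"
    by simp
  have zip: "zip (replicate (r + s) 1 @ [2] @ replicate t 1)
       (replicate r 1 @ replicate (s + t + 1) (-1)) =
      replicate r (1, 1) @ replicate s (1, -1) @ (2, -1) # replicate t (1 :: nat, -1 :: int)"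
    unfolding eq by (simp only: replicate_add) simp
  have "rev (map (shifted_term p) (zip (replicate (r + s) 1 @ [2] @ replicate t 1)
       (replicate r 1 @ replicate (s + t + 1) (-1)))) = mixed_word p r s t"
    unfolding zip by (simp add: shifted_term_eq shifted_term_eq(1)[simplified] mixed_word_def)
  thus ?thesis
    using rat_cong_mixed_sum[OF assms, of "replicate (r + s) 1 @ [2] @ replicate t 1"
        "replicate r 1 @ replicate (s + t + 1) (-1)"] by simp
qed

section \<open>Rational sequences representing elements of the quotient ring\<close>

text \<open>The prime \<open>2\<close> is dropped because the identity over the rationals needs \<open>p\<close> odd.\<close>

definition represents :: "(nat \<Rightarrow> rat) \<Rightarrow> fin_adele \<Rightarrow> bool" where
  "represents x z \<longleftrightarrow> (\<forall>p. prime p \<longrightarrow> p \<noteq> 2 \<longrightarrow> p_integral p (x p)) \<and>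
     z = abs_fin_adele (prime_prod_of (\<lambda>p. rat_mod p (x p)))"

text \<open>The difference is supported on \<open>{2}\<close>, hence lies in the direct sum.\<close>

lemma abs_fin_adele_eqI:
  assumes "\<And>p. prime p \<Longrightarrow> p \<noteq> 2 \<Longrightarrow> [f p = g p] (mod int p)"
  shows "abs_fin_adele (prime_prod_of f) = abs_fin_adele (prime_prod_of g)"
proof -
  have "component (prime_prod_of f - prime_prod_of g) p = 0" if "p \<noteq> 2" for p
  proof (cases "prime p")
    case True
    thus ?thesis
      using assms[of p] that
      by (simp add: minus_prime_prod.rep_eq component_prime_prod_of cong_def)
  qed (simp add: minus_prime_prod.rep_eq)
  hence "{p. component (prime_prod_of f - prime_prod_of g) p \<noteq> 0} \<subseteq> {2}"
    by blast
  hence "finite {p. component (prime_prod_of f - prime_prod_of g) p \<noteq> 0}"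
    by (rule finite_subset) simp
  thus ?thesis
    by (simp add: fin_adele.abs_eq_iff cong_direct_sum_def prime_direct_sum_def)
qed

lemma represents_cong:
  assumes "represents x z" "\<And>p. prime p \<Longrightarrow> p \<noteq> 2 \<Longrightarrow> rat_cong p (x p) (y p)"
  shows "represents y z"
  using assms unfolding represents_def rat_cong_def by (auto intro!: abs_fin_adele_eqI)

lemma represents_unique:
  assumes "represents x z" "represents y z'" "\<And>p. prime p \<Longrightarrow> p \<noteq> 2 \<Longrightarrow> x p = y p"
  shows "z = z'"
  using assms unfolding represents_def by (auto intro!: abs_fin_adele_eqI)

lemma represents_add:
  assumes "represents x z" "represents y w"
  shows "represents (\<lambda>p. x p + y p) (z + w)"
proof -
  have "prime_prod_of f + prime_prod_of g = prime_prod_of (\<lambda>p. f p + g p)" for f g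
    by (rule prime_prod_eqI)
       (simp add: plus_prime_prod.rep_eq component_prime_prod_of mod_add_eq)
  hence "z + w = abs_fin_adele (prime_prod_of (\<lambda>p. rat_mod p (x p) + rat_mod p (y p)))"
    using assms by (simp add: represents_def plus_fin_adele.abs_eq)
  also have "\<dots> = abs_fin_adele (prime_prod_of (\<lambda>p. rat_mod p (x p + y p)))"
    using assms by (intro abs_fin_adele_eqI cong_sym[OF rat_mod_add(2)]) (auto simp: represents_def)
  finally show ?thesis
    using assms by (auto simp: represents_def rat_mod_add(1))
qed

lemma represents_mult:
  assumes "represents x z" "represents y w"
  shows "represents (\<lambda>p. x p * y p) (z * w)"
proof -
  have "prime_prod_of f * prime_prod_of g = prime_prod_of (\<lambda>p. f p * g p)" for f g
    by (rule prime_prod_eqI)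
       (simp add: times_prime_prod.rep_eq component_prime_prod_of mod_mult_eq)
  hence "z * w = abs_fin_adele (prime_prod_of (\<lambda>p. rat_mod p (x p) * rat_mod p (y p)))"
    using assms by (simp add: represents_def times_fin_adele.abs_eq)
  also have "\<dots> = abs_fin_adele (prime_prod_of (\<lambda>p. rat_mod p (x p * y p)))"
    using assms by (intro abs_fin_adele_eqI cong_sym[OF rat_mod_mult(2)]) (auto simp: represents_def)
  finally show ?thesis
    using assms by (auto simp: represents_def rat_mod_mult(1))
qed

lemma represents_1: "represents (\<lambda>_. 1) 1"
proof -
  have "prime_prod_of (\<lambda>p. rat_mod p 1) = 1"
    using rat_mod_of_int[of _ 1]
    by (intro prime_prod_eqI)
       (simp add: one_prime_prod.rep_eq component_prime_prod_of cong_def)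
  thus ?thesis
    using p_integral_of_int[of _ 1] by (simp add: represents_def one_fin_adele_def)
qed

lemma represents_0: "represents (\<lambda>_. 0) 0"
proof -
  have "prime_prod_of (\<lambda>p. rat_mod p 0) = 0"
    using rat_mod_of_int[of _ 0]
    by (intro prime_prod_eqI)
       (simp add: zero_prime_prod.rep_eq component_prime_prod_of cong_def)
  thus ?thesis
    using p_integral_of_int[of _ 0] by (simp add: represents_def zero_fin_adele_def)
qed

lemma represents_minus_1: "represents (\<lambda>_. - 1) (- 1)"
proof -
  define z where "z = abs_fin_adele (prime_prod_of (\<lambda>p. rat_mod p (- 1)))"
  have z: "represents (\<lambda>_. - 1) z"
    using p_integral_of_int[of _ "- 1"] by (simp add: represents_def z_def)
  have "1 + z = 0"
    by (rule represents_unique[OF represents_add[OF represents_1 z] represents_0]) simp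
  thus ?thesis
    using z by (metis add_eq_0_iff)
qed

lemma represents_uminus: "represents x z \<Longrightarrow> represents (\<lambda>p. - x p) (- z)"
  using represents_mult[OF represents_minus_1, of x z] by simp

lemma represents_of_nat: "represents (\<lambda>_. of_nat n) (of_nat n)"
  by (induction n) (simp_all add: represents_0 represents_add represents_1)

lemma represents_power: "represents x z \<Longrightarrow> represents (\<lambda>p. x p ^ k) (z ^ k)"
  by (induction k) (simp_all add: represents_1 represents_mult)

lemma represents_sum:
  "(\<And>i. i \<in> I \<Longrightarrow> represents (x i) (z i)) \<Longrightarrow> represents (\<lambda>p. \<Sum>i\<in>I. x i p) (\<Sum>i\<in>I. z i)"
  by (induction I rule: infinite_finite_induct) (simp_all add: represents_0 represents_add)

lemma represents_mixed_value:
  "represents (\<lambda>p. chain_sum (mixed_word p r s t) p)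
     (fin_mixed_value (replicate (r + s) 1 @ [2] @ replicate t 1)
        (replicate r 1 @ replicate (s + t + 1) (-1)))"
proof -
  have "represents (\<lambda>p. mixed_sum p (replicate (r + s) 1 @ [2] @ replicate t 1)
        (replicate r 1 @ replicate (s + t + 1) (-1)))
      (fin_mixed_value (replicate (r + s) 1 @ [2] @ replicate t 1)
        (replicate r 1 @ replicate (s + t + 1) (-1)))"
    using rat_cong_mixed_word[of _ r s t]
    unfolding represents_def fin_mixed_value_def rat_cong_def by auto
  thus ?thesis
    by (rule represents_cong) (rule rat_cong_mixed_word)
qed

lemma represents_t_value:
  assumes "j \<le> n"
  shows "represents (\<lambda>p. chain_sum (mixed_word p 0 j (n - j)) p)
    (fin_t_value (replicate j 1 @ [2] @ replicate (n - j) 1))"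
  using represents_mixed_value[of 0 j "n - j"] assms by (simp add: fin_t_value_def)

theorem corollary3p5:
  fixes a m :: nat
  assumes "m \<le> a"
  shows "of_nat ((a + 1) choose (m + 1)) *
           (\<Sum>j = 0..a + 1. fin_t_value (replicate j 1 @ [2] @ replicate (a + 1 - j) 1)) +
         (-1) ^ m *
           (\<Sum>j = 0..a - m. fin_t_value (replicate j 1 @ [2] @ replicate (a + 1 - j) 1)) =
         - (\<Sum>i = 0..a. \<Sum>j = 0..i.
              of_nat (i choose (a - m)) *
              fin_mixed_value (replicate (a + 1 - j) 1 @ [2] @ replicate j 1)
                              (replicate (a + 1 - i) 1 @ replicate (i + 1) (-1)))"
    (is "?L = - ?R")
proof (rule represents_unique)
  let ?M = "\<lambda>p r s t. chain_sum (mixed_word p r s t) p"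
  show "represents (\<lambda>p. of_nat ((a + 1) choose (m + 1)) * (\<Sum>j = 0..a + 1. ?M p 0 j (a + 1 - j)) +
      (- 1) ^ m * (\<Sum>j = 0..a - m. ?M p 0 j (a + 1 - j))) ?L"
    by (intro represents_add represents_mult represents_of_nat represents_power
        represents_minus_1 represents_sum represents_t_value) auto
  \<comment> \<open>Take \<open>r = a + 1 - i\<close>, \<open>s = i - j\<close>,
    \<open>t = j\<close>; then \<open>r + s = a + 1 - j\<close> and
    \<open>s + t + 1 = i + 1\<close>, as \<open>j \<le> i \<le> a\<close>.\<close>
  have "represents (\<lambda>p. ?M p (a + 1 - i) (i - j) j)
      (fin_mixed_value (replicate (a + 1 - j) 1 @ [2] @ replicate j 1)
        (replicate (a + 1 - i) 1 @ replicate (i + 1) (-1)))" if "j \<le> i" "i \<le> a" for i j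
    using represents_mixed_value[of "a + 1 - i" "i - j" j] that by simp
  thus "represents (\<lambda>p. - (\<Sum>i = 0..a. \<Sum>j = 0..i.
      of_nat (i choose (a - m)) * ?M p (a + 1 - i) (i - j) j)) (- ?R)"
    by (intro represents_uminus represents_sum represents_mult represents_of_nat) auto
  fix p :: nat
  assume "prime p" "p \<noteq> 2"
  hence "odd p"
    using prime_odd_nat prime_gt_1_nat[of p] by force
  \<comment> \<open>At odd primes the representing rationals agree exactly, not merely modulo
    \<open>p\<close>.\<close>
  then obtain q where "p = Suc (2 * q)"
    by (auto elim: oddE)
  thus "of_nat ((a + 1) choose (m + 1)) * (\<Sum>j = 0..a + 1. ?M p 0 j (a + 1 - j)) +
      (- 1) ^ m * (\<Sum>j = 0..a - m. ?M p 0 j (a + 1 - j)) =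
      - (\<Sum>i = 0..a. \<Sum>j = 0..i. of_nat (i choose (a - m)) * ?M p (a + 1 - i) (i - j) j)"
    using mixed_word_identity[OF assms, of q] by (simp only:)
qed

end
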